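(* Let $A$ be a $PT$-matrix of type 2(c). Then $A$ has finite multiplicative order if and only if $A$ or its transpose is permutation similar to the matrix $(C_p\oplus C_q)+T(1,n,h+1,n-l)$, where $n=p+q$, $1\le h<p$, $1\le l<q$, and $\gcd(p,q)$ divides at least one of $h$ and $l$. When this occurs, the multiplicative order of $A$ is $\mathrm{lcm}(p,q)$.
   Context: $C_k$ is the $k\times k$ permutation matrix with $1$ in positions $(i+1,i)$ for $1\le i\le k-1$ and in position $(1,k)$ (companion matrix of $x^k-1$); $\oplus$ is the matrix direct sum. A $T$-block $T(i_1,j_1,i_2,j_2)$ (with $i_1\ne i_2$, $j_1\ne j_2$) is the $n\times n$ matrix with $1$ in positions $(i_1,j_1),(i_2,j_2)$, $-1$ in positions $(i_1,j_2),(i_2,j_1)$, $0$ elsewhere. A $PT$-matrix is $P+T$ with $P$ a permutation matrix and $T$ a $T$-block. Its digraph has vertices $w_1,\dots,w_n$, a blue arc $(w_i,w_j)$ when the $(i,j)$ entry is $1$ and a red arc when it is $-1$. A $PT$-matrix $P+T$ is of type 2(c) if the non-zero positions of $T$ are disjoint from the $1$'s of $P$, the permutation $P$ has exactly two cycles, and, writing the red arcs as $(u_1,v_1),(u_2,v_2)$, the vertices $u_1,u_2$ lie in one cycle of $P$ and $v_1,v_2$ in the other. Matrices $A,B$ are permutation similar if $B=R^TAR$ for a permutation matrix $R$. *)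

theory Defs
  imports "Jordan_Normal_Form.Matrix" "HOL-Combinatorics.Orbits" "HOL-Combinatorics.Permutations"
begin

text \<open>
  Rows, columns and vertices are numbered from \<open>0\<close> to \<open>n - 1\<close>, following the convention for
  \<^typ>\<open>int mat\<close>; a position \<open>(i, j)\<close> of the usual 1-based notation is \<open>(i - 1, j - 1)\<close> here.
\<close>

text \<open>The permutation matrix whose digraph has the arcs \<open>(i, \<pi> i)\<close>.\<close>

definition perm_mat :: "nat \<Rightarrow> (nat \<Rightarrow> nat) \<Rightarrow> int mat" where
  "perm_mat n \<pi> = mat n n (\<lambda>(i, j). if \<pi> i = j then 1 else 0)"

definition is_perm_mat :: "nat \<Rightarrow> int mat \<Rightarrow> bool" where
  "is_perm_mat n P \<longleftrightarrow> (\<exists>\<pi>. \<pi> permutes {..<n} \<and> P = perm_mat n \<pi>)"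

definition perm_similar :: "nat \<Rightarrow> int mat \<Rightarrow> int mat \<Rightarrow> bool" where
  "perm_similar n A B \<longleftrightarrow> (\<exists>R. is_perm_mat n R \<and> A = transpose_mat R * B * R)"

text \<open>Vertex sets of the cycles of \<open>\<pi>\<close>; a fixed point is a cycle of length 1 (a loop).\<close>

definition cycles_of :: "nat \<Rightarrow> (nat \<Rightarrow> nat) \<Rightarrow> nat set set" where
  "cycles_of n \<pi> = orbit \<pi> ` {..<n}"

definition is_T_block_index :: "nat \<Rightarrow> nat \<Rightarrow> nat \<Rightarrow> nat \<Rightarrow> nat \<Rightarrow> bool" where
  "is_T_block_index n i\<^sub>1 j\<^sub>1 i\<^sub>2 j\<^sub>2 \<longleftrightarrow>
     i\<^sub>1 < n \<and> j\<^sub>1 < n \<and> i\<^sub>2 < n \<and> j\<^sub>2 < n \<and> i\<^sub>1 \<noteq> i\<^sub>2 \<and> j\<^sub>1 \<noteq> j\<^sub>2"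

definition T_block :: "nat \<Rightarrow> nat \<Rightarrow> nat \<Rightarrow> nat \<Rightarrow> nat \<Rightarrow> int mat" where
  "T_block n i\<^sub>1 j\<^sub>1 i\<^sub>2 j\<^sub>2 = mat n n (\<lambda>p.
     if p = (i\<^sub>1, j\<^sub>1) \<or> p = (i\<^sub>2, j\<^sub>2) then 1
     else if p = (i\<^sub>1, j\<^sub>2) \<or> p = (i\<^sub>2, j\<^sub>1) then - 1
     else 0)"

definition is_T_block :: "nat \<Rightarrow> int mat \<Rightarrow> bool" where
  "is_T_block n T \<longleftrightarrow>
     (\<exists>i\<^sub>1 j\<^sub>1 i\<^sub>2 j\<^sub>2. is_T_block_index n i\<^sub>1 j\<^sub>1 i\<^sub>2 j\<^sub>2 \<and> T = T_block n i\<^sub>1 j\<^sub>1 i\<^sub>2 j\<^sub>2)"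

definition red_arcs :: "int mat \<Rightarrow> (nat \<times> nat) set" where
  "red_arcs A = {(i, j). i < dim_row A \<and> j < dim_col A \<and> A $$ (i, j) = - 1}"

definition PT_type_2c :: "nat \<Rightarrow> int mat \<Rightarrow> bool" where
  "PT_type_2c n A \<longleftrightarrow> (\<exists>\<pi> T. \<pi> permutes {..<n} \<and> is_T_block n T \<and> A = perm_mat n \<pi> + T \<and>
     (\<forall>i<n. \<forall>j<n. T $$ (i, j) \<noteq> 0 \<longrightarrow> perm_mat n \<pi> $$ (i, j) \<noteq> 1) \<and>
     card (cycles_of n \<pi>) = 2 \<and>
     (\<exists>u\<^sub>1 v\<^sub>1 u\<^sub>2 v\<^sub>2. red_arcs A = {(u\<^sub>1, v\<^sub>1), (u\<^sub>2, v\<^sub>2)} \<and> (u\<^sub>1, v\<^sub>1) \<noteq> (u\<^sub>2, v\<^sub>2) \<and>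
       (\<exists>C \<in> cycles_of n \<pi>. \<exists>D \<in> cycles_of n \<pi>.
          C \<noteq> D \<and> u\<^sub>1 \<in> C \<and> u\<^sub>2 \<in> C \<and> v\<^sub>1 \<in> D \<and> v\<^sub>2 \<in> D)))"

definition cyc_mat :: "nat \<Rightarrow> int mat" where
  "cyc_mat k = mat k k (\<lambda>(i, j). if i = j + 1 \<or> i = 0 \<and> j = k - 1 then 1 else 0)"

text \<open>
  \<open>(C\<^sub>p \<oplus> C\<^sub>q) + T(1, n, h + 1, n - l)\<close> with \<open>n = p + q\<close>, written with 0-based positions.
\<close>

definition canonical_2c :: "nat \<Rightarrow> nat \<Rightarrow> nat \<Rightarrow> nat \<Rightarrow> int mat" where
  "canonical_2c p q h l = (let n = p + q in
     diag_block_mat [cyc_mat p, cyc_mat q] + T_block n 0 (n - 1) h (n - l - 1))"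

definition canonical_params :: "nat \<Rightarrow> nat \<Rightarrow> nat \<Rightarrow> nat \<Rightarrow> nat \<Rightarrow> bool" where
  "canonical_params n p q h l \<longleftrightarrow>
     n = p + q \<and> 1 \<le> h \<and> h < p \<and> 1 \<le> l \<and> l < q \<and> (gcd p q dvd h \<or> gcd p q dvd l)"

definition finite_mult_order :: "int mat \<Rightarrow> bool" where
  "finite_mult_order A \<longleftrightarrow> (\<exists>k>0. A ^\<^sub>m k = 1\<^sub>m (dim_row A))"

text \<open>Only meaningful for square matrices of finite multiplicative order.\<close>

definition mult_order :: "int mat \<Rightarrow> nat" where
  "mult_order A = (LEAST k. k > 0 \<and> A ^\<^sub>m k = 1\<^sub>m (dim_row A))"

end

theory Submission
  imports Defs
begin

text \<open>
  A matrix of type 2(c) is \<open>P + x y\<^sup>T\<close> with \<open>x\<close> supported on one cycle of \<open>P\<close> and \<open>y\<close> on the other, so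
  \<open>y\<^sup>T P\<^sup>k x = 0\<close> for all \<open>k\<close> and the \<open>k\<close>-th power is \<open>P\<^sup>k\<close> plus the sum of the
  \<open>P\<^sup>a x y\<^sup>T P\<^sup>b\<close> with \<open>a + b = k - 1\<close>. Numbering both cycles against the arcs, the first one
  starting and the second one ending at an end point of a red arc, turns the matrix into the canonical
  form for some \<open>h\<close> and \<open>l\<close>; no transposition is needed. A power equal to the identity has an exponent
  divisible by both cycle lengths \<open>p\<close> and \<open>q\<close>, and for such exponents the sum counts simultaneous
  solutions of congruences modulo \<open>p\<close> and \<open>q\<close>. It vanishes exactly when \<open>gcd p q\<close> divides \<open>h\<close> or \<open>l\<close>.
\<close>

section \<open>Powers of a permutation matrix with a rank one perturbation\<close>

lemma pow_mat_commute:
  assumes "A \<in> carrier_mat n n"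
  shows "A ^\<^sub>m k * A = A * A ^\<^sub>m k"
proof (induction k)
  case 0
  then show ?case using assms by simp
next
  case (Suc k)
  then show ?case using assms
    by (simp add: assoc_mult_mat[of A n n "A ^\<^sub>m k" n A n])
qed

lemma transpose_pow_mat:
  fixes A :: "'a :: comm_semiring_1 mat"
  assumes "A \<in> carrier_mat n n"
  shows "transpose_mat (A ^\<^sub>m k) = transpose_mat A ^\<^sub>m k"
proof (induction k)
  case 0
  then show ?case using assms by simp
next
  case (Suc k)
  have "transpose_mat (A ^\<^sub>m Suc k) = transpose_mat A * transpose_mat (A ^\<^sub>m k)"
    using assms by (simp add: transpose_mult[of _ n n _ n])
  also have "\<dots> = transpose_mat A ^\<^sub>m Suc k"
    using Suc pow_mat_commute[of "transpose_mat A" n k] assms by simp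
  finally show ?case .
qed

text \<open>The induction splits off one factor on the left. Every product with two perturbation
  factors contains some \<open>\<Sum>m<n. y m * x ((f ^^ a) m)\<close>, which \<open>orth\<close>
  makes zero, so only the terms with a single perturbation factor survive.\<close>

lemma pow_rank_one_perturbation:
  fixes x y :: "nat \<Rightarrow> 'a :: comm_ring_1"
  assumes B: "B = mat n n (\<lambda>(i, j). of_bool (f i = j) + x i * y j)"
    and f: "\<And>i. i < n \<Longrightarrow> f i < n"
    and orth: "\<And>k. (\<Sum>m<n. y m * x ((f ^^ k) m)) = 0"
  shows "i < n \<Longrightarrow> j < n \<Longrightarrow> (B ^\<^sub>m k) $$ (i, j) = of_bool ((f ^^ k) i = j) +
    (\<Sum>a<k. x ((f ^^ a) i) * (\<Sum>m<n. y m * of_bool ((f ^^ (k - 1 - a)) m = j)))"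
proof (induction k arbitrary: i)
  case 0
  then show ?case using B by simp
next
  case (Suc k)
  have cB: "B \<in> carrier_mat n n"
    using B by simp
  let ?c = "\<lambda>k. (\<Sum>m<n. y m * of_bool ((f ^^ k) m = j))"
  have "(B ^\<^sub>m Suc k) $$ (i, j) = (\<Sum>m<n. B $$ (i, m) * (B ^\<^sub>m k) $$ (m, j))"
    using cB Suc.prems pow_mat_commute[OF cB, of k]
    by (simp add: scalar_prod_def atLeast0LessThan)
  also have "\<dots> = (\<Sum>m<n. of_bool (f i = m) * (B ^\<^sub>m k) $$ (m, j)) +
      x i * (\<Sum>m<n. y m * (B ^\<^sub>m k) $$ (m, j))"
    using Suc.prems unfolding B
    by (simp add: algebra_simps sum.distrib sum_distrib_left)
  also have "(\<Sum>m<n. of_bool (f i = m) * (B ^\<^sub>m k) $$ (m, j)) = (B ^\<^sub>m k) $$ (f i, j)"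
    using f[of i] Suc.prems by (simp add: of_bool_def if_distribR if_distrib[of "\<lambda>c. c * _"] cong: if_cong)
  also have "\<dots> = of_bool ((f ^^ Suc k) i = j) + (\<Sum>a<k. x ((f ^^ Suc a) i) * ?c (k - 1 - a))"
    using Suc.IH[of "f i"] f[of i] Suc.prems by (simp add: funpow_swap1)
  also have "(\<Sum>m<n. y m * (B ^\<^sub>m k) $$ (m, j)) =
      ?c k + (\<Sum>m<n. \<Sum>a<k. y m * x ((f ^^ a) m) * ?c (k - 1 - a))"
    using Suc.IH Suc.prems
    by (simp add: distrib_left sum.distrib sum_distrib_left mult.assoc)
  also have "(\<Sum>m<n. \<Sum>a<k. y m * x ((f ^^ a) m) * ?c (k - 1 - a)) = 0"
    by (subst sum.swap) (simp add: orth flip: sum_distrib_right)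
  \<comment> \<open>The product \<open>x i * ?c k\<close> becomes the summand for
    \<open>a = 0\<close>, and the other summands move up by one.\<close>
  finally show ?case
    by (simp add: sum.lessThan_Suc_shift del: sum.lessThan_Suc)
qed

section \<open>Sums of periodic functions\<close>

text \<open>Translation permutes the residues modulo \<open>k\<close>. The argument of
  \<open>F\<close> is an integer so that the shift \<open>t\<close> may be negative.\<close>

lemma sum_periodic_shift:
  fixes F :: "int \<Rightarrow> 'a :: comm_monoid_add"
  assumes per: "\<And>a. F (a mod int k) = F a"
  shows "(\<Sum>a<k. F (int a + t)) = (\<Sum>a<k. F (int a))"
proof (cases "k = 0")
  case False
  have "(\<Sum>a<k. F (int a + t)) = (\<Sum>a\<in>{0..<int k}. F (a + t))"
    by (rule sum.reindex_bij_witness[of _ nat int]) auto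
  also have "\<dots> = (\<Sum>a\<in>{0..<int k}. F a)"
    by (rule sum.reindex_bij_witness[of _ "\<lambda>a. (a - t) mod int k" "\<lambda>a. (a + t) mod int k"])
      (use False per in \<open>auto simp: mod_simps\<close>)
  also have "\<dots> = (\<Sum>a<k. F (int a))"
    by (rule sum.reindex_bij_witness[of _ int nat]) auto
  finally show ?thesis .
qed simp

text \<open>As \<open>gcd p q\<close> divides \<open>l\<close>, some multiple of \<open>p\<close> is congruent to \<open>l\<close> modulo \<open>q\<close>; shifting the
  summation index by it moves \<open>w\<close> by \<open>l\<close> and leaves \<open>f\<close> fixed.\<close>

lemma sum_mult_periodic_shift:
  fixes f w :: "int \<Rightarrow> 'a :: comm_semiring_1" and p q k :: nat and l :: int
  assumes f: "\<And>a b. int p dvd a - b \<Longrightarrow> f a = f b"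
    and w: "\<And>a b. int q dvd a - b \<Longrightarrow> w a = w b"
    and k: "p dvd k" "q dvd k" and g: "int (gcd p q) dvd l"
  shows "(\<Sum>a<k. f (int a) * w (int a + l)) = (\<Sum>a<k. f (int a) * w (int a))"
proof -
  obtain u v where uv: "u * int p + v * int q = l"
  proof -
    obtain c where c: "l = int (gcd p q) * c"
      using g by (rule dvdE)
    obtain u v where "u * int p + v * int q = int (gcd p q)"
      using bezout_int[of "int p" "int q"] by auto
    then have "(c * u) * int p + (c * v) * int q = l"
      unfolding c by (metis distrib_left mult.assoc mult.commute)
    then show thesis by (rule that)
  qed
  \<comment> \<open>Both periods divide \<open>k\<close>, so the sum runs over whole periods of the
    product and may be shifted.\<close>
  have "f (a mod int k) = f a" "w (a mod int k) = w a" for a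
    using k by (auto intro!: f w intro: dvd_trans[of _ "int k"] simp: mod_eq_dvd_iff[symmetric])
  then have "(\<Sum>a<k. f (int a) * w (int a)) = (\<Sum>a<k. f (int a + u * int p) * w (int a + u * int p))"
    using sum_periodic_shift[of "\<lambda>a. f a * w a" k "u * int p"] by simp
  also have "\<dots> = (\<Sum>a<k. f (int a) * w (int a + l))"
  proof (rule sum.cong[OF refl])
    fix a
    have "f (int a + u * int p) = f (int a)"
      by (rule f) simp
    moreover have "w (int a + u * int p) = w (int a + l)"
      by (rule w) (simp flip: uv)
    ultimately show "f (int a + u * int p) * w (int a + u * int p) = f (int a) * w (int a + l)"
      by simp
  qed
  finally show ?thesis ..
qed

section \<open>The index map and the entries of the canonical matrix\<close>

text \<open>The permutation of the direct sum of two matrices \<open>cyc_mat\<close>, in the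
  direction of the arcs: their ones lie just below the diagonal and in the upper right corner, so a
  step lowers the index and wraps around at the start of a block.\<close>

definition two_shift :: "nat \<Rightarrow> nat \<Rightarrow> nat \<Rightarrow> nat" where
  "two_shift p q i = (if i = 0 then p - 1 else if i = p then p + q - 1 else i - 1)"

text \<open>Read through residues, the map is subtraction of one in each block. This removes the
  case distinction, so iterates simply subtract the exponent.\<close>

lemma two_shift_mod:
  assumes "0 < p" "0 < q"
  shows "two_shift p q (nat (z mod int p)) = nat ((z - 1) mod int p)"
    and "two_shift p q (p + nat (z mod int q)) = p + nat ((z - 1) mod int q)"
proof -
  have pred: "(z - 1) mod int m = (if z mod int m = 0 then int m - 1 else z mod int m - 1)"
    if "0 < m" for m
  proof (cases "z mod int m = 0")
    case True
    then have "(z - 1) mod int m = (- 1) mod int m"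
      by (metis diff_0 mod_diff_left_eq)
    then show ?thesis using that True by (simp add: zmod_minus1)
  next
    case False
    have "0 \<le> z mod int m" "z mod int m < int m"
      using that by simp_all
    then have "(z mod int m - 1) mod int m = z mod int m - 1"
      using False by (intro mod_pos_pos_trivial) auto
    then show ?thesis using False by (simp add: mod_simps)
  qed
  have "0 \<le> z mod int p" "z mod int p < int p" "0 \<le> z mod int q" "z mod int q < int q"
    using assms by simp_all
  moreover have "nat (z mod int p) < p"
    using assms by (simp add: nat_less_iff)
  ultimately show "two_shift p q (nat (z mod int p)) = nat ((z - 1) mod int p)"
    and "two_shift p q (p + nat (z mod int q)) = p + nat ((z - 1) mod int q)"
    using assms by (auto simp: pred two_shift_def nat_diff_distrib dest: order_antisym)
qed

lemma funpow_two_shift: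
  assumes "0 < p" "0 < q"
  shows "i < p \<Longrightarrow> (two_shift p q ^^ a) i = nat ((int i - int a) mod int p)"
    and "d < q \<Longrightarrow> (two_shift p q ^^ a) (p + d) = p + nat ((int d - int a) mod int q)"
  by (induction a) (simp_all add: two_shift_mod[OF assms] algebra_simps)

text \<open>Turns reachability along a cycle into a congruence on the exponent, the form in which
  entries of powers are counted below.\<close>

lemma funpow_two_shift_eq_iff:
  assumes "0 < p" "0 < q"
  shows "i < p \<Longrightarrow> c < p \<Longrightarrow> (two_shift p q ^^ a) i = c \<longleftrightarrow> int p dvd int a - int i + int c"
    and "d < q \<Longrightarrow> c < q \<Longrightarrow> (two_shift p q ^^ a) (p + d) = p + c \<longleftrightarrow> int q dvd int a - int d + int c"
    and "i < p \<Longrightarrow> (two_shift p q ^^ a) i < p"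
proof -
  have *: "nat ((int i - int a) mod int m) = c \<longleftrightarrow> int m dvd int a - int i + int c"
    if "0 < m" "c < m" for i m c
  proof -
    have "nat ((int i - int a) mod int m) = c \<longleftrightarrow> (int i - int a) mod int m = int c mod int m"
      using that by auto
    also have "\<dots> \<longleftrightarrow> int m dvd int c - (int i - int a)"
      by (metis mod_eq_dvd_iff)
    finally show ?thesis by (simp add: algebra_simps)
  qed
  show "i < p \<Longrightarrow> c < p \<Longrightarrow> (two_shift p q ^^ a) i = c \<longleftrightarrow> int p dvd int a - int i + int c"
    "d < q \<Longrightarrow> c < q \<Longrightarrow> (two_shift p q ^^ a) (p + d) = p + c \<longleftrightarrow> int q dvd int a - int d + int c"
    "i < p \<Longrightarrow> (two_shift p q ^^ a) i < p"
    using assms by (simp_all add: funpow_two_shift * nat_less_iff)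
qed

text \<open>Exhibits the rank one shape, a column vector times a row vector, on which the expansion
  of powers rests.\<close>

lemma T_block_eq:
  assumes "i\<^sub>1 \<noteq> i\<^sub>2" "j\<^sub>1 \<noteq> j\<^sub>2"
  shows "T_block n i\<^sub>1 j\<^sub>1 i\<^sub>2 j\<^sub>2 =
    mat n n (\<lambda>(i, j). (of_bool (i = i\<^sub>1) - of_bool (i = i\<^sub>2)) * (of_bool (j = j\<^sub>1) - of_bool (j = j\<^sub>2)))"
  unfolding T_block_def using assms by (intro cong_mat) auto

lemma canonical_2c_eq:
  assumes "h < p" "0 < h" "l < q" "0 < l"
  shows "canonical_2c p q h l = mat (p + q) (p + q) (\<lambda>(i, j). of_bool (two_shift p q i = j) +
    (of_bool (i = 0) - of_bool (i = h)) * (of_bool (j = p + (q - 1)) - of_bool (j = p + (q - 1 - l))))"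
proof -
  have diag: "diag_block_mat [cyc_mat p, cyc_mat q] =
      mat (p + q) (p + q) (\<lambda>(i, j). of_bool (two_shift p q i = j))"
    (is "?D = ?S")
  proof (rule eq_matI)
    fix i j assume "i < dim_row ?S" "j < dim_col ?S"
    then have ij: "i < p + q" "j < p + q" by simp_all
    show "?D $$ (i, j) = ?S $$ (i, j)"
      using assms ij by (cases "i < p"; cases "j < p") (auto simp: Let_def cyc_mat_def two_shift_def)
  qed (simp_all add: Let_def cyc_mat_def)
  have "p + q - 1 = p + (q - 1)" "p + q - l - 1 = p + (q - 1 - l)"
    using assms by auto
  then have "canonical_2c p q h l = mat (p + q) (p + q) (\<lambda>(i, j). of_bool (two_shift p q i = j)) +
      T_block (p + q) 0 (p + (q - 1)) h (p + (q - 1 - l))"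
    unfolding canonical_2c_def Let_def diag by simp
  then show ?thesis
    using assms by (subst (asm) T_block_eq) (auto intro!: eq_matI)
qed


lemma sum_diff_of_bool_mult:
  fixes F :: "nat \<Rightarrow> 'a :: ring_1"
  assumes "u < n" "v < n"
  shows "(\<Sum>m<n. (of_bool (m = u) - of_bool (m = v)) * F m) = F u - F v"
  using assms by (simp add: left_diff_distrib sum_subtractf of_bool_def if_distribR
      if_distrib[of "\<lambda>c. c * _"] cong: if_cong)

section \<open>Powers of the canonical matrix\<close>

text \<open>Orthogonality holds because the row vector is supported on the second block, which
  iterates of \<open>two_shift\<close> never leave, whereas the column vector is supported at
  \<open>0\<close> and \<open>h\<close> in the first.\<close>

lemma canonical_2c_pow_index:
  assumes hl: "h < p" "0 < h" "l < q" "0 < l" and ij: "i < p + q" "j < p + q"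
  defines "s \<equiv> two_shift p q"
  shows "(canonical_2c p q h l ^\<^sub>m k) $$ (i, j) = of_bool ((s ^^ k) i = j) +
    (\<Sum>a<k. (of_bool ((s ^^ a) i = 0) - of_bool ((s ^^ a) i = h)) *
      (of_bool ((s ^^ (k - 1 - a)) (p + (q - 1)) = j) - of_bool ((s ^^ (k - 1 - a)) (p + (q - 1 - l)) = j)))"
proof -
  let ?x = "\<lambda>i. of_bool (i = 0) - of_bool (i = h) :: int"
  let ?y = "\<lambda>j. of_bool (j = p + (q - 1)) - of_bool (j = p + (q - 1 - l)) :: int"
  have y: "(\<Sum>m<p + q. ?y m * F m) = F (p + (q - 1)) - F (p + (q - 1 - l))" for F
    using hl by (intro sum_diff_of_bool_mult) auto
  have s_less: "s i < p + q" if "i < p + q" for i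
    using that hl by (auto simp: s_def two_shift_def)
  have "?x ((s ^^ b) (p + d)) = 0" if "d < q" for b d
    using that hl by (simp add: s_def funpow_two_shift)
  from this[of "q - 1"] this[of "q - 1 - l"]
  have "(\<Sum>m<p + q. ?y m * ?x ((s ^^ b) m)) = 0" for b
    unfolding y using hl by (simp only: diff_self)
  from pow_rank_one_perturbation[OF canonical_2c_eq[OF hl] _ this[unfolded s_def], folded s_def,
      OF s_less ij]
  show ?thesis by (simp only: y)
qed

text \<open>Only in this upper right block can the correction sum be non-zero. As \<open>q\<close>
  divides \<open>k\<close>, the exponent \<open>k\<close> drops out of the congruences modulo
  \<open>q\<close>.\<close>

lemma canonical_2c_pow_off_diagonal:
  assumes hl: "h < p" "0 < h" "l < q" "0 < l" and ij: "i < p" "d < q" and k: "q dvd k"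
  shows "(canonical_2c p q h l ^\<^sub>m k) $$ (i, p + d) =
    (\<Sum>a<k. (of_bool (int p dvd int a - int i) - of_bool (int p dvd int a - int i + int h)) *
      (of_bool (int q dvd int a - int d) - of_bool (int q dvd int a - int d - int l)))"
proof -
  let ?s = "two_shift p q"
  have pq: "0 < p" "0 < q" using hl by auto
  have ne: "(?s ^^ a) i \<noteq> p + d" for a
    using funpow_two_shift_eq_iff(3)[OF pq ij(1), of a] by simp
  \<comment> \<open>Used with \<open>e = 0\<close> and \<open>e = l\<close>, the two columns in the
    support of the row vector.\<close>
  have w: "(?s ^^ (k - 1 - a)) (p + (q - 1 - e)) = p + d \<longleftrightarrow> int q dvd int a - int d - int e"
    if "a < k" "e < q" for a e
  proof -
    have "(?s ^^ (k - 1 - a)) (p + (q - 1 - e)) = p + d \<longleftrightarrow>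
        int q dvd int (k - 1 - a) - int (q - 1 - e) + int d"
      using pq ij by (intro funpow_two_shift_eq_iff) auto
    \<comment> \<open>The decrements in \<open>k - 1\<close> and \<open>q - 1\<close> cancel,
      leaving two multiples of \<open>q\<close>.\<close>
    also have "int (k - 1 - a) - int (q - 1 - e) + int d = int k - int q - (int a - int d - int e)"
      using that by (simp add: of_nat_diff)
    also have "int q dvd \<dots> \<longleftrightarrow> int q dvd int a - int d - int e"
      using k by (intro dvd_diff_right_iff) simp
    finally show ?thesis .
  qed
  have "(canonical_2c p q h l ^\<^sub>m k) $$ (i, p + d) = of_bool ((?s ^^ k) i = p + d) +
    (\<Sum>a<k. (of_bool ((?s ^^ a) i = 0) - of_bool ((?s ^^ a) i = h)) *
      (of_bool ((?s ^^ (k - 1 - a)) (p + (q - 1 - 0)) = p + d) -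
       of_bool ((?s ^^ (k - 1 - a)) (p + (q - 1 - l)) = p + d)))"
    using canonical_2c_pow_index[OF hl, of i "p + d" k] ij by simp
  then show ?thesis
    using hl pq ij ne by (simp add: w[of _ 0, simplified] w[of _ l, simplified] funpow_two_shift_eq_iff)
qed

text \<open>A row of the second block never reaches the support of the column vector, and the
  iterates of the row vector's support never reach a column of the first block.\<close>

lemma canonical_2c_pow_diagonal:
  assumes hl: "h < p" "0 < h" "l < q" "0 < l" and ij: "i < p + q" "j < p + q" "p \<le> i \<or> j < p"
  shows "(canonical_2c p q h l ^\<^sub>m k) $$ (i, j) = of_bool ((two_shift p q ^^ k) i = j)"
proof -
  let ?s = "two_shift p q"
  have pq: "0 < p" "0 < q" using hl by auto
  have D: "p \<le> (?s ^^ a) (p + d)" if "d < q" for a d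
    using funpow_two_shift(2)[OF pq that] by simp
  have "(of_bool ((?s ^^ a) i = 0) - of_bool ((?s ^^ a) i = h)) *
      (of_bool ((?s ^^ b) (p + (q - 1)) = j) - of_bool ((?s ^^ b) (p + (q - 1 - l)) = j)) = (0 :: int)" for a b
  proof (cases "p \<le> i")
    case True
    then have "p \<le> (?s ^^ a) i"
      using D[of "i - p" a] ij by simp
    then show ?thesis using hl by simp
  next
    case False
    then show ?thesis
      using D[of "q - 1" b] D[of "q - 1 - l" b] ij pq by auto
  qed
  then show ?thesis
    by (simp only: canonical_2c_pow_index[OF hl ij(1,2)]) simp
qed

text \<open>If \<open>gcd p q\<close> divides neither \<open>h\<close> nor \<open>l\<close>, then in the entry \<open>(0, p)\<close> of the \<open>k\<close>-th power,
  expanded into four sums, both sums with a negative sign are empty, while \<open>a = 0\<close>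
  contributes to the first sum.\<close>

lemma canonical_2c_pow_eq_one_iff:
  assumes hl: "h < p" "0 < h" "l < q" "0 < l" and k: "0 < k"
  shows "canonical_2c p q h l ^\<^sub>m k = 1\<^sub>m (p + q) \<longleftrightarrow>
    lcm p q dvd k \<and> (gcd p q dvd h \<or> gcd p q dvd l)"
proof
  let ?B = "canonical_2c p q h l"
  have pq: "0 < p" "0 < q" using hl by auto
  assume eq: "?B ^\<^sub>m k = 1\<^sub>m (p + q)"
  \<comment> \<open>The diagonal entries at \<open>0\<close> and at \<open>p\<close>, one in each
    block, force divisibility by \<open>p\<close> and by \<open>q\<close>.\<close>
  have pk: "p dvd k"
    using canonical_2c_pow_diagonal[OF hl, of 0 0 k] funpow_two_shift_eq_iff(1)[OF pq, of 0 0 k] eq pq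
    by (simp split: if_splits)
  have qk: "q dvd k"
    using canonical_2c_pow_diagonal[OF hl, of p p k] funpow_two_shift_eq_iff(2)[OF pq, of 0 0 k] eq pq
    by (simp split: if_splits)
  have "gcd p q dvd h \<or> gcd p q dvd l"
  proof (rule ccontr)
    let ?f = "\<lambda>a. (of_bool (int p dvd int a) - of_bool (int p dvd int a + int h)) *
      (of_bool (int q dvd int a) - of_bool (int q dvd int a - int l)) :: int"
    assume "\<not> (gcd p q dvd h \<or> gcd p q dvd l)"
    then have ndvd: "\<not> int (gcd p q) dvd int h" "\<not> int (gcd p q) dvd int l"
      unfolding of_nat_dvd_iff by blast+
    have g: "int (gcd p q) dvd z" if "int p dvd z \<or> int q dvd z" for z
      using that by (metis dvd_trans gcd_dvd1 gcd_dvd2 of_nat_dvd_iff)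
    have 1: "\<not> (int p dvd int a + int h \<and> int q dvd int a)" for a
      using ndvd(1) g[of "int a"] g[of "int a + int h"] dvd_add_right_iff by blast
    have 2: "\<not> (int p dvd int a \<and> int q dvd int a - int l)" for a
      using ndvd(2) g[of "int a"] g[of "int a - int l"] dvd_diff_right_iff by blast
    have f: "?f a = of_bool (int p dvd int a \<and> int q dvd int a) +
        of_bool (int p dvd int a + int h \<and> int q dvd int a - int l)" for a
      using 1[of a] 2[of a] by (auto simp del: of_nat_dvd_iff)
    have "?f 0 \<le> (\<Sum>a<k. ?f a)"
      by (rule member_le_sum) (use k f in auto)
    moreover have "?f 0 \<ge> 1"
      unfolding f by simp
    moreover have "(\<Sum>a<k. ?f a) = 0"
      using canonical_2c_pow_off_diagonal[OF hl pq qk] eq pq by simp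
    ultimately show False by simp
  qed
  with pk qk show "lcm p q dvd k \<and> (gcd p q dvd h \<or> gcd p q dvd l)" by simp
next
  let ?B = "canonical_2c p q h l"
  have pq: "0 < p" "0 < q" using hl by auto
  assume asm: "lcm p q dvd k \<and> (gcd p q dvd h \<or> gcd p q dvd l)"
  then have pk: "p dvd k" and qk: "q dvd k" by auto
  show "?B ^\<^sub>m k = 1\<^sub>m (p + q)"
  proof (rule eq_matI)
    fix i j assume "i < dim_row (1\<^sub>m (p + q) :: int mat)" "j < dim_col (1\<^sub>m (p + q) :: int mat)"
    then have ij: "i < p + q" "j < p + q" by simp_all
    show "(?B ^\<^sub>m k) $$ (i, j) = 1\<^sub>m (p + q) $$ (i, j)"
    proof (cases "p \<le> i \<or> j < p")
      case True
      have "(two_shift p q ^^ k) i = i"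
      proof (cases "i < p")
        case True
        then show ?thesis using pk by (simp add: funpow_two_shift_eq_iff pq)
      next
        case False
        then have "i = p + (i - p)" "i - p < q" using ij by auto
        then show ?thesis using qk funpow_two_shift_eq_iff(2)[OF pq, of "i - p" "i - p" k] by simp
      qed
      then show ?thesis using ij by (simp add: canonical_2c_pow_diagonal[OF hl ij True])
    next
      case False
      \<comment> \<open>In the upper right block the entry is a sum of products of a
        \<open>p\<close>-periodic difference, built from \<open>f\<close>, and a
        \<open>q\<close>-periodic one, built from \<open>w\<close>.\<close>
      define d where "d = j - p"
      have d: "j = p + d" "d < q" "i < p" using False ij by (auto simp: d_def)
      define f where "f a = (of_bool (int p dvd a - int i) :: int)" for a
      define w where "w a = (of_bool (int q dvd a - int d) :: int)" for a
      have fp: "f a = f b" if "int p dvd a - b" for a b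
        using that dvd_add_right_iff[of "int p" "a - b" "b - int i"] by (simp add: f_def)
      have wp: "w a = w b" if "int q dvd a - b" for a b
        using that dvd_add_right_iff[of "int q" "a - b" "b - int d"] by (simp add: w_def)
      have "(?B ^\<^sub>m k) $$ (i, j) =
          (\<Sum>a<k. (f (int a) - f (int a + int h)) * (w (int a) - w (int a + - int l)))"
        unfolding d canonical_2c_pow_off_diagonal[OF hl d(3,2) qk] f_def w_def
        by (simp only: add_diff_eq diff_add_eq diff_conv_add_uminus ac_simps)
      also have "\<dots> = 0"
      proof (cases "gcd p q dvd l")
        case True
        \<comment> \<open>Shifting \<open>w\<close> by \<open>- int l\<close> does not change its
          sum against any \<open>p\<close>-periodic factor, so the two halves of the difference in
          \<open>w\<close> cancel. The other case exchanges the roles of \<open>p\<close> and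
          \<open>q\<close>.\<close>
        then have "int (gcd p q) dvd - int l" by (simp only: dvd_minus_iff of_nat_dvd_iff)
        then have 1: "(\<Sum>a<k. f' (int a) * w (int a + - int l)) = (\<Sum>a<k. f' (int a) * w (int a))"
          if "\<And>a b. int p dvd a - b \<Longrightarrow> f' a = f' b" for f'
          by (intro sum_mult_periodic_shift[of p _ q] that wp pk qk)
        have "(\<Sum>a<k. (f (int a) - f (int a + int h)) * w (int a + - int l)) =
            (\<Sum>a<k. (f (int a) - f (int a + int h)) * w (int a))"
          by (rule 1) (metis fp add_diff_cancel_right)
        then show ?thesis by (simp add: right_diff_distrib sum_subtractf)
      next
        case False
        then have "gcd q p dvd h" using asm by (simp add: gcd.commute)
        then have "int (gcd q p) dvd int h" by (simp only: of_nat_dvd_iff)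
        then have 1: "(\<Sum>a<k. w' (int a) * f (int a + int h)) = (\<Sum>a<k. w' (int a) * f (int a))"
          if "\<And>a b. int q dvd a - b \<Longrightarrow> w' a = w' b" for w'
          by (intro sum_mult_periodic_shift[of q _ p] that fp pk qk)
        have "(\<Sum>a<k. (w (int a) - w (int a + - int l)) * f (int a + int h)) =
            (\<Sum>a<k. (w (int a) - w (int a + - int l)) * f (int a))"
          by (rule 1) (metis wp add_diff_cancel_right)
        then show ?thesis by (simp add: left_diff_distrib sum_subtractf mult.commute)
      qed
      finally show ?thesis using d ij by simp
    qed
  qed (use canonical_2c_eq[OF hl] in simp_all)
qed

section \<open>Permutation similarity as renaming of indices\<close>

lemma perm_mat_mult_transpose:
  assumes "\<tau> permutes {..<n}"
  shows "perm_mat n \<tau> * transpose_mat (perm_mat n \<tau>) = 1\<^sub>m n"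
    and "transpose_mat (perm_mat n \<tau>) * perm_mat n \<tau> = 1\<^sub>m n"
proof -
  have less: "\<tau> i < n" if "i < n" for i
    using assms permutes_in_image[of \<tau> "{..<n}" i] that by simp
  show "perm_mat n \<tau> * transpose_mat (perm_mat n \<tau>) = 1\<^sub>m n"
  proof (rule eq_matI)
    fix i j assume "i < dim_row (1\<^sub>m n :: int mat)" "j < dim_col (1\<^sub>m n :: int mat)"
    then show "(perm_mat n \<tau> * transpose_mat (perm_mat n \<tau>)) $$ (i, j) = 1\<^sub>m n $$ (i, j)"
      using less inj_eq[OF permutes_inj[OF assms]]
      by (simp add: perm_mat_def scalar_prod_def if_distrib[of "\<lambda>c. c * _"] cong: if_cong)
  qed (simp_all add: perm_mat_def)
  show "transpose_mat (perm_mat n \<tau>) * perm_mat n \<tau> = 1\<^sub>m n"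
  proof (rule eq_matI)
    fix i j assume ij: "i < dim_row (1\<^sub>m n :: int mat)" "j < dim_col (1\<^sub>m n :: int mat)"
    let ?g = "\<lambda>a. (if a = i then 1 else 0) * (if a = j then 1 else 0) :: int"
    have "(transpose_mat (perm_mat n \<tau>) * perm_mat n \<tau>) $$ (i, j) = sum (?g \<circ> \<tau>) {..<n}"
      using ij by (simp add: perm_mat_def scalar_prod_def atLeast0LessThan o_def)
    also have "\<dots> = sum ?g {..<n}"
      by (rule sum.permute[OF assms, symmetric])
    also have "\<dots> = 1\<^sub>m n $$ (i, j)"
      using ij by (simp add: if_distrib[of "\<lambda>c. c * _"] cong: if_cong)
    finally show "(transpose_mat (perm_mat n \<tau>) * perm_mat n \<tau>) $$ (i, j) = 1\<^sub>m n $$ (i, j)" .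
  qed (simp_all add: perm_mat_def)
qed

lemma perm_mat_conjugate_index:
  assumes "\<tau> permutes {..<n}" "A \<in> carrier_mat n n" "i < n" "j < n"
  shows "(perm_mat n \<tau> * A * transpose_mat (perm_mat n \<tau>)) $$ (i, j) = A $$ (\<tau> i, \<tau> j)"
proof -
  have less: "\<tau> i < n" if "i < n" for i
    using assms permutes_in_image[of \<tau> "{..<n}" i] that by simp
  have "(perm_mat n \<tau> * A) $$ (i, m) = A $$ (\<tau> i, m)" if "m < n" for m
    using assms less[of i] that
    by (simp add: perm_mat_def scalar_prod_def if_distrib[of "\<lambda>c. c * _"] cong: if_cong)
  then show ?thesis
    using assms less[of j]
    by (simp add: perm_mat_def scalar_prod_def if_distrib[of "\<lambda>c. _ * c"] cong: if_cong)
qed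

text \<open>Conjugation by a permutation matrix only renames indices, so a numbering of the vertices
  is enough to establish similarity. Here \<open>\<tau>\<close> sends indices of \<open>B\<close> to
  indices of \<open>A\<close>.\<close>

lemma perm_similar_iff_index:
  assumes "A \<in> carrier_mat n n" "B \<in> carrier_mat n n"
  shows "perm_similar n A B \<longleftrightarrow>
    (\<exists>\<tau>. \<tau> permutes {..<n} \<and> (\<forall>i<n. \<forall>j<n. B $$ (i, j) = A $$ (\<tau> i, \<tau> j)))"
proof -
  have "A = transpose_mat R * B * R \<longleftrightarrow> B = R * A * transpose_mat R"
    if "R = perm_mat n \<tau>" "\<tau> permutes {..<n}" for R \<tau>
  proof -
    have R: "R \<in> carrier_mat n n" "transpose_mat R \<in> carrier_mat n n" using that by (simp_all add: perm_mat_def)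
    show ?thesis
      using similar_mat_wit_sym[of A B "transpose_mat R" R] similar_mat_wit_sym[of B A R "transpose_mat R"]
        perm_mat_mult_transpose[OF that(2)] assms R
      unfolding similar_mat_wit_def Let_def that(1) by auto
  qed
  moreover have "B = perm_mat n \<tau> * A * transpose_mat (perm_mat n \<tau>) \<longleftrightarrow>
      (\<forall>i<n. \<forall>j<n. B $$ (i, j) = A $$ (\<tau> i, \<tau> j))" if "\<tau> permutes {..<n}" for \<tau>
    using perm_mat_conjugate_index[OF that assms(1)] assms(2)
    by (auto simp: mat_eq_iff perm_mat_def)
  ultimately show ?thesis
    unfolding perm_similar_def is_perm_mat_def by metis
qed

lemma perm_similar_pow_eq_one_iff:
  assumes "perm_similar n A B" "B \<in> carrier_mat n n"
  shows "A ^\<^sub>m k = 1\<^sub>m n \<longleftrightarrow> B ^\<^sub>m k = 1\<^sub>m n"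
proof -
  obtain \<tau> where \<tau>: "\<tau> permutes {..<n}"
      and A: "A = transpose_mat (perm_mat n \<tau>) * B * perm_mat n \<tau>"
    using assms(1) unfolding perm_similar_def is_perm_mat_def by blast
  let ?R = "perm_mat n \<tau>"
  have R: "?R \<in> carrier_mat n n" "transpose_mat ?R \<in> carrier_mat n n" by (simp_all add: perm_mat_def)
  have wit: "similar_mat_wit A B (transpose_mat ?R) ?R"
    using perm_mat_mult_transpose[OF \<tau>] assms(2) R A by (intro similar_mat_witI[of _ _ n]) auto
  show ?thesis
    using similar_mat_wit_pow_id[OF wit, of k] similar_mat_wit_pow_id[OF similar_mat_wit_sym[OF wit], of k]
      perm_mat_mult_transpose[OF \<tau>] R by auto
qed

section \<open>Reduction of type 2(c) to the canonical form\<close>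

text \<open>The number \<open>p\<close> is the first return time of \<open>x\<close>, the length of
  its cycle.\<close>

lemma orbit_enumeration:
  assumes "\<pi> permutes S" "finite S"
  obtains p where "0 < p" "(\<pi> ^^ p) x = x" "bij_betw (\<lambda>m. (\<pi> ^^ m) x) {..<p} (orbit \<pi> x)"
proof -
  have x: "x \<in> orbit \<pi> x"
    using assms by (intro permutation_self_in_orbit) (auto simp: permutation_permutes)
  show thesis
    using that[of "funpow_dist1 \<pi> x x"] funpow_dist1_prop[OF x] inj_on_funpow_dist1[OF x]
      orbit_conv_funpow_dist1[OF x]
    by (simp add: bij_betw_def atLeast0LessThan)
qed

text \<open>The ones of the permutation matrix avoid the T-block and cannot cancel its negative
  entries, so \<open>(i\<^sub>1, j\<^sub>2)\<close> and \<open>(i\<^sub>2, j\<^sub>1)\<close> are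
  red arcs. Hence the two rows lie in one cycle and the two columns in the other, and two cycles
  already cover all vertices.\<close>

lemma PT_type_2cE:
  assumes "PT_type_2c n A"
  obtains \<pi> i\<^sub>1 i\<^sub>2 j\<^sub>1 j\<^sub>2 where "\<pi> permutes {..<n}"
    "A = mat n n (\<lambda>(i, j). of_bool (\<pi> i = j) +
      (of_bool (i = i\<^sub>1) - of_bool (i = i\<^sub>2)) * (of_bool (j = j\<^sub>1) - of_bool (j = j\<^sub>2)))"
    "i\<^sub>1 < n" "j\<^sub>1 < n" "i\<^sub>1 \<noteq> i\<^sub>2" "j\<^sub>1 \<noteq> j\<^sub>2" "i\<^sub>2 \<in> orbit \<pi> i\<^sub>1" "j\<^sub>2 \<in> orbit \<pi> j\<^sub>1"
    "orbit \<pi> i\<^sub>1 \<inter> orbit \<pi> j\<^sub>1 = {}" "orbit \<pi> i\<^sub>1 \<union> orbit \<pi> j\<^sub>1 = {..<n}"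
proof -
  from assms obtain \<pi> T where \<pi>: "\<pi> permutes {..<n}" and T: "is_T_block n T"
    and A: "A = perm_mat n \<pi> + T"
    and disj: "\<forall>i<n. \<forall>j<n. T $$ (i, j) \<noteq> 0 \<longrightarrow> perm_mat n \<pi> $$ (i, j) \<noteq> 1"
    and card: "card (cycles_of n \<pi>) = 2"
    and red: "\<exists>u\<^sub>1 v\<^sub>1 u\<^sub>2 v\<^sub>2. red_arcs A = {(u\<^sub>1, v\<^sub>1), (u\<^sub>2, v\<^sub>2)} \<and> (u\<^sub>1, v\<^sub>1) \<noteq> (u\<^sub>2, v\<^sub>2) \<and>
       (\<exists>C \<in> cycles_of n \<pi>. \<exists>D \<in> cycles_of n \<pi>.
          C \<noteq> D \<and> u\<^sub>1 \<in> C \<and> u\<^sub>2 \<in> C \<and> v\<^sub>1 \<in> D \<and> v\<^sub>2 \<in> D)"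
    unfolding PT_type_2c_def by blast
  from T obtain i\<^sub>1 j\<^sub>1 i\<^sub>2 j\<^sub>2 where idx: "i\<^sub>1 < n" "j\<^sub>1 < n" "i\<^sub>2 < n" "j\<^sub>2 < n" "i\<^sub>1 \<noteq> i\<^sub>2" "j\<^sub>1 \<noteq> j\<^sub>2"
    and Teq: "T = T_block n i\<^sub>1 j\<^sub>1 i\<^sub>2 j\<^sub>2"
    unfolding is_T_block_def is_T_block_index_def by blast
  have "A $$ (i\<^sub>1, j\<^sub>2) = - 1" "A $$ (i\<^sub>2, j\<^sub>1) = - 1"
    using idx disj[rule_format, of i\<^sub>1 j\<^sub>2] disj[rule_format, of i\<^sub>2 j\<^sub>1]
    unfolding A Teq by (auto simp: perm_mat_def T_block_def)
  then have "(i\<^sub>1, j\<^sub>2) \<in> red_arcs A" "(i\<^sub>2, j\<^sub>1) \<in> red_arcs A"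
    using idx by (auto simp: red_arcs_def A Teq T_block_def perm_mat_def)
  moreover from red obtain u\<^sub>1 v\<^sub>1 u\<^sub>2 v\<^sub>2 C D where "red_arcs A = {(u\<^sub>1, v\<^sub>1), (u\<^sub>2, v\<^sub>2)}"
    and CD: "C \<in> cycles_of n \<pi>" "D \<in> cycles_of n \<pi>" "C \<noteq> D"
    and "u\<^sub>1 \<in> C" "u\<^sub>2 \<in> C" "v\<^sub>1 \<in> D" "v\<^sub>2 \<in> D"
    by metis
  ultimately have mem: "i\<^sub>1 \<in> C" "i\<^sub>2 \<in> C" "j\<^sub>1 \<in> D" "j\<^sub>2 \<in> D"
    by auto
  \<comment> \<open>Every vertex generates its own cycle, so distinct cycles are disjoint.\<close>
  have cyc: "E = orbit \<pi> x" if "E \<in> cycles_of n \<pi>" "x \<in> E" for E x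
    using that orbit_cyclic_eq3[OF cyclic_on_orbit[OF \<pi> finite_lessThan]] by (auto simp: cycles_of_def)
  have perm: "permutation \<pi>" using \<pi> by (auto simp: permutation_permutes)
  have "cycles_of n \<pi> = {C, D}"
    using card CD by (auto simp: card_2_iff)
  moreover have "\<Union> (cycles_of n \<pi>) = {..<n}"
    using permutes_orbit_subset[OF \<pi>] permutation_self_in_orbit[OF perm]
    unfolding cycles_of_def by blast
  ultimately have un: "C \<union> D = {..<n}" by simp
  have int: "C \<inter> D = {}"
    using cyc CD by blast
  have C: "orbit \<pi> i\<^sub>1 = C" and D: "orbit \<pi> j\<^sub>1 = D"
    using cyc CD mem by blast+
  have "A = mat n n (\<lambda>(i, j). of_bool (\<pi> i = j) +
      (of_bool (i = i\<^sub>1) - of_bool (i = i\<^sub>2)) * (of_bool (j = j\<^sub>1) - of_bool (j = j\<^sub>2)))"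
    unfolding A Teq T_block_eq[OF idx(5,6)] by (intro eq_matI) (auto simp: perm_mat_def)
  from that[OF \<pi> this idx(1,2,5,6)] show thesis
    unfolding C D using mem un int by simp
qed

lemma PT_type_2c_perm_similar_canonical:
  assumes "PT_type_2c n A"
  obtains p q h l where "n = p + q" "h < p" "0 < h" "l < q" "0 < l"
    "perm_similar n A (canonical_2c p q h l)"
proof -
  from assms obtain \<pi> i\<^sub>1 i\<^sub>2 j\<^sub>1 j\<^sub>2 where \<pi>: "\<pi> permutes {..<n}"
    and A: "A = mat n n (\<lambda>(i, j). of_bool (\<pi> i = j) +
      (of_bool (i = i\<^sub>1) - of_bool (i = i\<^sub>2)) * (of_bool (j = j\<^sub>1) - of_bool (j = j\<^sub>2)))"
    and idx: "i\<^sub>1 < n" "j\<^sub>1 < n" "i\<^sub>1 \<noteq> i\<^sub>2" "j\<^sub>1 \<noteq> j\<^sub>2" "i\<^sub>2 \<in> orbit \<pi> i\<^sub>1" "j\<^sub>2 \<in> orbit \<pi> j\<^sub>1"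
    and int: "orbit \<pi> i\<^sub>1 \<inter> orbit \<pi> j\<^sub>1 = {}" and un: "orbit \<pi> i\<^sub>1 \<union> orbit \<pi> j\<^sub>1 = {..<n}"
    by (rule PT_type_2cE)
  obtain p where p: "0 < p" "(\<pi> ^^ p) i\<^sub>1 = i\<^sub>1" "bij_betw (\<lambda>m. (\<pi> ^^ m) i\<^sub>1) {..<p} (orbit \<pi> i\<^sub>1)"
    by (rule orbit_enumeration[OF \<pi> finite_lessThan])
  obtain q where q: "0 < q" "(\<pi> ^^ q) j\<^sub>1 = j\<^sub>1" "bij_betw (\<lambda>m. (\<pi> ^^ m) j\<^sub>1) {..<q} (orbit \<pi> j\<^sub>1)"
    by (rule orbit_enumeration[OF \<pi> finite_lessThan])
  have imC: "orbit \<pi> i\<^sub>1 = (\<lambda>m. (\<pi> ^^ m) i\<^sub>1) ` {..<p}" and imD: "orbit \<pi> j\<^sub>1 = (\<lambda>m. (\<pi> ^^ m) j\<^sub>1) ` {..<q}"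
    using p(3) q(3) by (auto simp: bij_betw_def)
  have "finite (orbit \<pi> i\<^sub>1)" "finite (orbit \<pi> j\<^sub>1)"
    unfolding imC imD by auto
  then have n: "n = p + q"
    using card_Un_disjoint[of "orbit \<pi> i\<^sub>1" "orbit \<pi> j\<^sub>1"] int un
      bij_betw_same_card[OF p(3)] bij_betw_same_card[OF q(3)] by simp
  obtain m where m: "m < p" "i\<^sub>2 = (\<pi> ^^ m) i\<^sub>1"
    using idx(5) unfolding imC by blast
  obtain l where l: "l < q" "j\<^sub>2 = (\<pi> ^^ l) j\<^sub>1"
    using idx(6) unfolding imD by blast
  have m0: "0 < m" using m idx by (cases m) auto
  have l0: "0 < l" using l idx by (cases l) auto
  \<comment> \<open>The vertex \<open>i\<^sub>2\<close> lies \<open>m\<close> steps after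
    \<open>i\<^sub>1\<close>, hence \<open>p - m\<close> steps before it on a cycle of length
    \<open>p\<close>.\<close>
  define h where "h = p - m"
  have h: "h < p" "0 < h" using m m0 by (auto simp: h_def)
  \<comment> \<open>Exponents fall as the index grows, because \<open>two_shift\<close> lowers
    indices. At index \<open>0\<close> the exponent \<open>p\<close> leads back to
    \<open>i\<^sub>1\<close>; the last branch is the identity that \<open>permutes\<close> demands
    outside the range.\<close>
  define \<rho> where "\<rho> i = (if i < p then (\<pi> ^^ (p - i)) i\<^sub>1
    else if i < n then (\<pi> ^^ (n - 1 - i)) j\<^sub>1 else i)" for i
  have \<rho>: "\<rho> 0 = i\<^sub>1" "\<rho> h = i\<^sub>2" "\<rho> (p + (q - 1)) = j\<^sub>1" "\<rho> (p + (q - 1 - l)) = j\<^sub>2"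
    using p q m m0 l n by (auto simp: \<rho>_def h_def)
  have pow_less: "(\<pi> ^^ k) x < n" if "x < n" for k x
    using permutes_in_image[OF \<pi>] that by (induction k) auto
  have "\<rho> ` {..<n} = {..<n}"
  proof
    show "\<rho> ` {..<n} \<subseteq> {..<n}"
      using pow_less idx by (auto simp: \<rho>_def)
    show "{..<n} \<subseteq> \<rho> ` {..<n}"
    proof
      fix x assume "x \<in> {..<n}"
      then consider k where "k < p" "x = (\<pi> ^^ k) i\<^sub>1" | k where "k < q" "x = (\<pi> ^^ k) j\<^sub>1"
        unfolding un[symmetric] imC imD by blast
      then show "x \<in> \<rho> ` {..<n}"
      proof cases
        case 1
        \<comment> \<open>Index \<open>p\<close> belongs to the second block, so the exponent
          \<open>0\<close> is represented by index \<open>0\<close>, whose exponent is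
          \<open>p\<close>.\<close>
        then have "x = \<rho> (if k = 0 then 0 else p - k)"
          using p by (auto simp: \<rho>_def)
        moreover have "(if k = 0 then 0 else p - k) < n"
          using p n by auto
        ultimately show ?thesis by blast
      next
        case 2
        then have "x = \<rho> (n - 1 - k)" "n - 1 - k < n"
          using n by (auto simp: \<rho>_def)
        then show ?thesis by blast
      qed
    qed
  qed
  then have "bij_betw \<rho> {..<n} {..<n}"
    by (simp add: bij_betw_def eq_card_imp_inj_on)
  then have perm: "\<rho> permutes {..<n}"
    by (rule bij_imp_permutes) (auto simp: \<rho>_def n)
  then have inj: "\<rho> i = \<rho> j \<longleftrightarrow> i = j" for i j
    by (intro inj_eq permutes_inj)
  have step: "\<pi> (\<rho> i) = \<rho> (two_shift p q i)" if "i < n" for i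
  proof -
    \<comment> \<open>The wrap-around cases \<open>i = 0\<close> and \<open>i = p\<close> use that
      the powers \<open>p\<close> and \<open>q\<close> of \<open>\<pi>\<close> fix
      \<open>i\<^sub>1\<close> and \<open>j\<^sub>1\<close>.\<close>
    consider "i = 0" | "0 < i" "i < p" | "i = p" | "p < i" by linarith
    then show ?thesis
    proof cases
      case 1
      then show ?thesis using p \<rho>(1) by (simp add: two_shift_def) (simp add: \<rho>_def)
    next
      case 2
      then have "p - (i - 1) = Suc (p - i)" "i - 1 < p" by simp_all
      then show ?thesis using 2 by (simp add: two_shift_def \<rho>_def del: Suc_pred' One_nat_def)
    next
      case 3
      then have "\<pi> (\<rho> i) = \<pi> ((\<pi> ^^ (q - 1)) j\<^sub>1)"
        using n q by (simp add: \<rho>_def)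
      also have "\<dots> = (\<pi> ^^ Suc (q - 1)) j\<^sub>1"
        by (simp only: funpow.simps o_apply)
      finally show ?thesis using 3 p q \<rho>(3) by (simp add: two_shift_def)
    next
      case 4
      then have "n - 1 - (i - 1) = Suc (n - 1 - i)" "\<not> i - 1 < p" "i - 1 < n" using that by simp_all
      then show ?thesis using 4 that by (simp add: two_shift_def \<rho>_def del: One_nat_def)
    qed
  qed
  have "perm_similar n A (canonical_2c p q h l)"
  proof (subst perm_similar_iff_index)
    show "A \<in> carrier_mat n n" by (simp add: A)
    show "canonical_2c p q h l \<in> carrier_mat n n"
      using canonical_2c_eq[OF h l(1) l0] n by simp
    have "canonical_2c p q h l $$ (i, j) = A $$ (\<rho> i, \<rho> j)" if "i < n" "j < n" for i j
    proof -
      have "\<rho> i < n" "\<rho> j < n"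
        using that perm permutes_in_image[of \<rho> "{..<n}"] by auto
      \<comment> \<open>Writing the four distinguished vertices as values of \<open>\<rho>\<close>
        reduces all comparisons of vertices to injectivity.\<close>
      then show ?thesis
        using that n unfolding A canonical_2c_eq[OF h l(1) l0] \<rho>[symmetric]
        by (simp add: step inj)
    qed
    with perm show "\<exists>\<tau>. \<tau> permutes {..<n} \<and>
        (\<forall>i<n. \<forall>j<n. canonical_2c p q h l $$ (i, j) = A $$ (\<tau> i, \<tau> j))" by blast
  qed
  from that[OF n h l(1) l0 this] show thesis .
qed

section \<open>Finiteness and value of the order\<close>

theorem theorem4p7:
  fixes n :: nat and A :: "int mat"
  assumes "PT_type_2c n A"
  shows "(finite_mult_order A \<longleftrightarrow>
            (\<exists>p q h l. canonical_params n p q h l \<and>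
               (perm_similar n A (canonical_2c p q h l) \<or>
                perm_similar n (transpose_mat A) (canonical_2c p q h l)))) \<and>
         (\<forall>p q h l. canonical_params n p q h l \<and>
               (perm_similar n A (canonical_2c p q h l) \<or>
                perm_similar n (transpose_mat A) (canonical_2c p q h l)) \<longrightarrow>
             mult_order A = lcm p q)"
proof -
  have A: "A \<in> carrier_mat n n"
    by (rule PT_type_2cE[OF assms]) simp
  have carrier: "canonical_2c p q h l \<in> carrier_mat (p + q) (p + q)"
    if "h < p" "0 < h" "l < q" "0 < l" for p q h l
    using canonical_2c_eq[OF that] by simp
  have transp: "transpose_mat A ^\<^sub>m k = 1\<^sub>m n \<longleftrightarrow> A ^\<^sub>m k = 1\<^sub>m n" for k
    using transpose_pow_mat[OF A, of k] by (metis transpose_one transpose_transpose)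
  \<comment> \<open>For admissible parameters the exponents giving the identity are exactly the
    multiples of \<open>lcm p q\<close>, which yields both finiteness and the order.\<close>
  have pow: "A ^\<^sub>m k = 1\<^sub>m (dim_row A) \<longleftrightarrow> lcm p q dvd k"
    if cp: "canonical_params n p q h l" and k: "0 < k" and
      sim: "perm_similar n A (canonical_2c p q h l) \<or>
        perm_similar n (transpose_mat A) (canonical_2c p q h l)" for p q h l k
  proof -
    from cp have hl: "h < p" "0 < h" "l < q" "0 < l"
      and n: "n = p + q" and g: "gcd p q dvd h \<or> gcd p q dvd l"
      by (auto simp: canonical_params_def)
    have "A ^\<^sub>m k = 1\<^sub>m n \<longleftrightarrow> canonical_2c p q h l ^\<^sub>m k = 1\<^sub>m n"
      using sim
    proof
      assume "perm_similar n A (canonical_2c p q h l)"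
      then show ?thesis
        using carrier[OF hl] unfolding n by (rule perm_similar_pow_eq_one_iff)
    next
      assume "perm_similar n (transpose_mat A) (canonical_2c p q h l)"
      then show ?thesis
        using carrier[OF hl] unfolding transp[symmetric] unfolding n by (rule perm_similar_pow_eq_one_iff)
    qed
    then show ?thesis
      using canonical_2c_pow_eq_one_iff[OF hl k] g A n by simp
  qed
  have lcm_pos: "0 < lcm p q" if "canonical_params n p q h l" for p q h l
    using that by (auto simp: canonical_params_def lcm_pos_nat)
  have "finite_mult_order A"
    if "canonical_params n p q h l" "perm_similar n A (canonical_2c p q h l) \<or>
        perm_similar n (transpose_mat A) (canonical_2c p q h l)" for p q h l
    unfolding finite_mult_order_def
    using lcm_pos[OF that(1)] pow[OF that(1) lcm_pos[OF that(1)] that(2)] by (intro exI[of _ "lcm p q"]) simp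
  moreover have "mult_order A = lcm p q"
    if "canonical_params n p q h l" "perm_similar n A (canonical_2c p q h l) \<or>
        perm_similar n (transpose_mat A) (canonical_2c p q h l)" for p q h l
    unfolding mult_order_def
    using lcm_pos[OF that(1)] pow[OF that(1) _ that(2)]
    by (intro Least_equality) (auto intro!: dvd_imp_le)
  \<comment> \<open>The canonical form exists for every matrix of type 2(c); finite order then
    supplies the condition on \<open>gcd p q\<close>. The alternative without transpose is the one
    obtained.\<close>
  moreover have "\<exists>p q h l. canonical_params n p q h l \<and> perm_similar n A (canonical_2c p q h l)"
    if fin: "finite_mult_order A"
  proof -
    obtain k where k: "0 < k" "A ^\<^sub>m k = 1\<^sub>m n"
      using fin A by (auto simp: finite_mult_order_def)
    obtain p q h l where n: "n = p + q" and hl: "h < p" "0 < h" "l < q" "0 < l"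
      and sim: "perm_similar n A (canonical_2c p q h l)"
      by (rule PT_type_2c_perm_similar_canonical[OF assms])
    have "canonical_2c p q h l ^\<^sub>m k = 1\<^sub>m (p + q)"
      using perm_similar_pow_eq_one_iff[OF sim] carrier[OF hl] k n by simp
    then have "canonical_params n p q h l"
      using canonical_2c_pow_eq_one_iff[OF hl k(1)] n hl by (auto simp: canonical_params_def)
    with sim show ?thesis by blast
  qed
  ultimately show ?thesis by blast
qed

end
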